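(* Let $F$ be a friend of $10$ written as $F=5^{2a_1}\cdot\prod_{i=2}^{\omega(F)}p_i^{2a_i}$, where $p_1=5$, the $p_i$ for $2\le i\le \omega(F)$ are distinct prime numbers with $p_i>5$, and $a_1,\dots,a_{\omega(F)}$ are positive integers. Then not all $a_i$ ($1\le i\le\omega(F)$) are congruent to $13$ modulo $27$; that is, there exists $i\in\{1,\dots,\omega(F)\}$ with $a_i\not\equiv 13\pmod{27}$.
   Context: For a positive integer $n$, $\sigma(n)$ denotes the sum of the positive divisors of $n$, $I(n)=\sigma(n)/n$ is the abundancy index of $n$, and $\omega(n)$ is the number of distinct prime divisors of $n$. Two distinct positive integers are friends of each other if they have the same abundancy index. Thus a friend of $10$ is a positive integer $F\neq 10$ with $I(F)=I(10)=9/5$, i.e. $5\sigma(F)=9F$. *)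

theory Defs
  imports "HOL-Number_Theory.Number_Theory"
begin

definition divisor_sum :: "nat \<Rightarrow> nat" where
  "divisor_sum n = (\<Sum>d | d dvd n. d)"

definition abundancy_index :: "nat \<Rightarrow> rat" where
  "abundancy_index n = of_nat (divisor_sum n) / of_nat n"

definition num_prime_divisors :: "nat \<Rightarrow> nat" where
  "num_prime_divisors n = card {p. prime p \<and> p dvd n}"

definition friends :: "nat \<Rightarrow> nat \<Rightarrow> bool" where
  "friends m n \<longleftrightarrow> m > 0 \<and> n > 0 \<and> m \<noteq> n \<and> abundancy_index m = abundancy_index n"

end

theory Submission
  imports Defs
begin

text \<open>
  If every \<open>a i\<close> is \<open>13\<close> modulo \<open>27\<close>, then \<open>27\<close> divides every \<open>2 * a i + 1\<close>. Hence
  \<open>1 + 5 + 5\<^sup>2 = 31\<close> divides \<open>\<sigma>(5 ^ (2 * a 1))\<close>, so it divides \<open>9 F\<close> and must be one of the primes \<open>p i\<close>.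
  As \<open>31\<close> is \<open>1\<close> modulo \<open>3\<close>, the sum \<open>1 + 31 + \<dots> + 31 ^ 26\<close> is divisible by \<open>27\<close>, and it divides
  \<open>\<sigma>(31 ^ (2 * a i))\<close>. So \<open>27\<close> divides \<open>9 F\<close>, which is impossible because \<open>F\<close> is coprime to \<open>3\<close>.
\<close>

lemma divisor_sum_mult_coprime:
  assumes "coprime m n"
  shows "divisor_sum (m * n) = divisor_sum m * divisor_sum n"
proof -
  let ?D = "{d. d dvd m} \<times> {e. e dvd n}"
  have inj: "inj_on (\<lambda>(d, e). d * e) ?D"
  proof (rule inj_onI, clarsimp)
    fix d e d' e'
    assume dvd: "d dvd m" "e dvd n" "d' dvd m" "e' dvd n" and eq: "d * e = d' * e'"
    \<comment> \<open>Divisors of \<open>m\<close> are coprime to divisors of \<open>n\<close>, so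
      \<open>d dvd d' * e'\<close> forces \<open>d dvd d'\<close>; the symmetric relations then give
      equality by antisymmetry.\<close>
    have "coprime d e'" "coprime d' e" "coprime e d'" "coprime e' d"
      using assms dvd by (meson coprime_divisors coprime_commute)+
    moreover have "d dvd d' * e'" "d' dvd d * e" "e dvd d' * e'" "e' dvd d * e"
      using eq by (metis dvd_triv_left dvd_triv_right)+
    ultimately show "d = d' \<and> e = e'"
      by (simp add: coprime_dvd_mult_left_iff coprime_dvd_mult_right_iff dvd_antisym)
  qed
  have img: "{d. d dvd m * n} = (\<lambda>(d, e). d * e) ` ?D"
    by (auto simp: image_iff intro: mult_dvd_mono dest!: division_decomp)
  show ?thesis
    unfolding divisor_sum_def img sum.reindex[OF inj]
    by (simp add: sum_product sum.cartesian_product case_prod_unfold)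
qed

lemma divisor_sum_prime_power:
  assumes "prime p"
  shows "divisor_sum (p ^ k) = (\<Sum>j<Suc k. p ^ j)"
proof -
  have "{d. d dvd p ^ k} = (\<lambda>j. p ^ j) ` {..<Suc k}"
    using assms by (auto simp: divides_primepow_nat image_iff less_Suc_eq_le)
  moreover have "inj_on (\<lambda>j. p ^ j) {..<Suc k}"
    using prime_gt_1_nat[OF assms] by (auto intro: inj_onI)
  ultimately show ?thesis
    unfolding divisor_sum_def by (simp add: sum.reindex)
qed

text \<open>Cut the \<open>n\<close> exponents into consecutive blocks of length \<open>m\<close>:
  each block is the first one multiplied by a power of \<open>x\<close>.\<close>

lemma sum_power_dvd_sum_power:
  fixes x :: "'a :: comm_semiring_1"
  assumes "m dvd n"
  shows "(\<Sum>j<m. x ^ j) dvd (\<Sum>j<n. x ^ j)"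
proof -
  obtain k where n: "n = k * m"
    using assms by (metis dvd_def mult.commute)
  have "(\<Sum>j<n. x ^ j) = (\<Sum>i<k. \<Sum>j=i*m..<i*m+m. x ^ j)"
    by (simp add: n sum.nat_group)
  also have "\<dots> = (\<Sum>i<k. x ^ (i * m) * (\<Sum>j<m. x ^ j))"
  proof (intro sum.cong refl)
    fix i
    show "(\<Sum>j=i*m..<i*m+m. x ^ j) = x ^ (i * m) * (\<Sum>j<m. x ^ j)"
      using sum.shift_bounds_nat_ivl[of "\<lambda>j. x ^ j" 0 "i * m" m]
      by (simp add: power_add sum_distrib_right atLeast0LessThan add.commute mult.commute)
  qed
  finally show ?thesis
    by (simp flip: sum_distrib_right)
qed

text \<open>Used for \<open>p = 5\<close>, \<open>m = 3\<close> and for \<open>p = 31\<close>,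
  \<open>m = 27\<close>. The condition involves \<open>Suc k\<close> because that is the number of
  terms in the geometric sum for \<open>p ^ k\<close>.\<close>

lemma sum_power_dvd_divisor_sum:
  assumes "prime p" "coprime (p ^ k) n" "m dvd Suc k"
  shows "(\<Sum>j<m. p ^ j) dvd divisor_sum (p ^ k * n)"
  unfolding divisor_sum_mult_coprime[OF assms(2)] divisor_sum_prime_power[OF assms(1)]
  by (intro dvd_mult2 sum_power_dvd_sum_power assms)

lemma friend_of_10_iff: "friends F 10 \<longleftrightarrow> F > 0 \<and> F \<noteq> 10 \<and> 5 * divisor_sum F = 9 * F"
proof -
  have "divisor_sum 10 = divisor_sum (2 ^ 1 * 5 ^ 1)"
    by simp
  also have "\<dots> = divisor_sum (2 ^ 1) * divisor_sum (5 ^ 1)"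
    by (rule divisor_sum_mult_coprime) (simp add: primes_coprime)
  also have "\<dots> = 18"
    by (subst (1 2) divisor_sum_prime_power) simp_all
  finally have d10: "divisor_sum 10 = 18" .
  have "abundancy_index F = abundancy_index 10 \<longleftrightarrow> 5 * divisor_sum F = 9 * F" if "F > 0"
  proof -
    have "abundancy_index F = abundancy_index 10 \<longleftrightarrow>
        (of_nat (5 * divisor_sum F) :: rat) = of_nat (9 * F)"
      using that by (simp add: abundancy_index_def d10 field_simps)
    thus ?thesis
      by (simp only: of_nat_eq_iff)
  qed
  thus ?thesis
    by (auto simp: friends_def)
qed

theorem theorem1p1:
  fixes F :: nat and p a :: "nat \<Rightarrow> nat"
  assumes "friends F 10"
    and "F = 5 ^ (2 * a 1) * (\<Prod>i = 2..num_prime_divisors F. p i ^ (2 * a i))"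
    and "p 1 = 5"
    and "\<forall>i\<in>{2..num_prime_divisors F}. prime (p i) \<and> p i > 5"
    and "inj_on p {2..num_prime_divisors F}"
    and "\<forall>i\<in>{1..num_prime_divisors F}. a i > 0"
  shows "\<exists>i\<in>{1..num_prime_divisors F}. \<not> [a i = 13] (mod 27)"
proof (rule ccontr)
  assume "\<not> ?thesis"
  then have cong: "[a i = 13] (mod 27)" if "i \<in> {1..num_prime_divisors F}" for i
    using that by blast
  define I where "I = {2..num_prime_divisors F}"
  define P where "P = (\<Prod>i\<in>I. p i ^ (2 * a i))"
  have F: "F = 5 ^ (2 * a 1) * P"
    using assms(2) by (simp add: P_def I_def)
  have finite_I: "finite I"
    by (simp add: I_def)
  have p: "prime (p i)" "p i > 5" if "i \<in> I" for i
    using assms(4) that by (auto simp: I_def)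
  have dvd27: "27 dvd Suc (2 * a i)" if "i \<in> {1..num_prime_divisors F}" for i
  proof -
    \<comment> \<open>The residue 13 matters because \<open>2 * 13 + 1 = 27\<close>.\<close>
    have "a i = 13 + 27 * (a i div 27)"
      using cong[OF that] mod_mult_div_eq[of "a i" 27] by (simp add: cong_def)
    then have "Suc (2 * a i) = 27 * (1 + 2 * (a i div 27))"
      by simp
    thus ?thesis
      by (metis dvd_triv_left)
  qed
  have "F > 0" and F_eq: "5 * divisor_sum F = 9 * F"
    using assms(1) by (auto simp: friend_of_10_iff)
  have prime5: "prime (5 :: nat)" and prime31: "prime (31 :: nat)" and prime3: "prime (3 :: nat)"
    by simp_all
  \<comment> \<open>Applied below to \<open>q = 31\<close>, to locate it among the
    \<open>p i\<close>, and to \<open>q = 3\<close>, for the contradiction.\<close>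
  have prime_dvd_F: "q = 5 \<or> (\<exists>i\<in>I. q = p i)" if "prime q" "q dvd F" for q
  proof -
    have "q dvd 5 ^ (2 * a 1) \<or> q dvd P"
      using that(2) unfolding F prime_dvd_mult_iff[OF that(1)] .
    then have "q dvd 5 \<or> (\<exists>i\<in>I. q dvd p i)"
      unfolding P_def prime_dvd_prod_iff[OF finite_I that(1)]
      by (auto dest: prime_dvd_power[OF that(1)])
    thus ?thesis
      by (auto dest: primes_dvd_imp_eq[OF that(1) prime5] primes_dvd_imp_eq[OF that(1) p(1)])
  qed

  \<comment> \<open>The congruence for \<open>a 1\<close> is available only if the index range is
    nonempty. It is, since \<open>5\<close> divides \<open>9 * F\<close> and hence
    \<open>F\<close>.\<close>
  have one: "1 \<in> {1..num_prime_divisors F}"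
  proof -
    have "5 dvd 9 * F"
      by (metis F_eq dvd_triv_left)
    moreover have "coprime 5 (9 :: nat)"
      using prime5 by (simp add: prime_imp_coprime)
    ultimately have "5 \<in> {q. prime q \<and> q dvd F}"
      by (simp add: coprime_dvd_mult_right_iff)
    moreover have "finite {q. prime q \<and> q dvd F}"
      using \<open>F > 0\<close> by simp
    ultimately have "num_prime_divisors F > 0"
      unfolding num_prime_divisors_def card_gt_0_iff by blast
    thus ?thesis
      by simp
  qed

  have "coprime (5 ^ (2 * a 1)) (p j ^ (2 * a j))" if "j \<in> I" for j
    using primes_coprime[OF prime5 p(1)[OF that]] p(2)[OF that] by simp
  then have "coprime (5 ^ (2 * a 1)) P"
    unfolding P_def by (rule prod_coprime_right)
  moreover have "3 dvd Suc (2 * a 1)"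
    using dvd27[OF one] by (rule dvd_trans[rotated]) simp
  ultimately have "(\<Sum>j<3. 5 ^ j) dvd divisor_sum F"
    unfolding F by (intro sum_power_dvd_divisor_sum) simp_all
  moreover have "(\<Sum>j<3. 5 ^ j) = (31 :: nat)"
    by (simp add: lessThan_nat_numeral)
  ultimately have "31 dvd divisor_sum F"
    by simp
  then have "31 dvd 9 * F"
    by (metis F_eq dvd_mult)
  moreover have "coprime 31 (9 :: nat)"
    using prime31 by (simp add: prime_imp_coprime)
  ultimately have "31 dvd F"
    by (simp add: coprime_dvd_mult_right_iff)
  then obtain i where i: "i \<in> I" "p i = 31"
    using prime_dvd_F[OF prime31] by auto

  \<comment> \<open>\<open>Q\<close> is the cofactor of the full power of \<open>31\<close> in
    \<open>F\<close>; injectivity of \<open>p\<close> ensures that \<open>31\<close> does not occur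
    in it again.\<close>
  define Q where "Q = 5 ^ (2 * a 1) * (\<Prod>j\<in>I - {i}. p j ^ (2 * a j))"
  have FQ: "F = 31 ^ (2 * a i) * Q"
    unfolding F P_def Q_def using i by (simp add: prod.remove[OF finite_I])
  have "coprime (31 ^ (2 * a i)) (p j ^ (2 * a j))" if "j \<in> I - {i}" for j
  proof -
    have "p j \<noteq> p i"
      using inj_onD[OF assms(5), of j i] i(1) that by (auto simp: I_def)
    thus ?thesis
      using primes_coprime[OF prime31 p(1)[of j]] that i(2) by simp
  qed
  then have "coprime (31 ^ (2 * a i)) (\<Prod>j\<in>I - {i}. p j ^ (2 * a j))"
    by (rule prod_coprime_right)
  then have "coprime (31 ^ (2 * a i)) Q"
    using primes_coprime[OF prime31 prime5] by (simp add: Q_def)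
  moreover have "27 dvd Suc (2 * a i)"
    using dvd27[of i] i(1) by (simp add: I_def)
  ultimately have "(\<Sum>j<27. 31 ^ j) dvd divisor_sum F"
    unfolding FQ by (intro sum_power_dvd_divisor_sum) simp_all
  \<comment> \<open>Checked by evaluation. Conceptually, the sum is
    \<open>(31 ^ 27 - 1) / 30\<close>, and by lifting the exponent its 3-adic valuation equals that
    of \<open>27\<close>.\<close>
  moreover have "27 dvd (\<Sum>j<27. 31 ^ j :: nat)"
    by (simp add: lessThan_nat_numeral)
  ultimately have "27 dvd 9 * F"
    by (metis F_eq dvd_mult dvd_trans)
  \<comment> \<open>The coefficient \<open>9\<close> absorbs only two of the three factors
    \<open>3\<close>; the third must divide \<open>F\<close>, whose prime divisors are all at least
    \<open>5\<close>.\<close>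
  then have "9 * 3 dvd 9 * F"
    by simp
  then have "3 dvd F"
    unfolding nat_mult_dvd_cancel_disj by simp
  then show False
    using prime_dvd_F[OF prime3] by (auto dest: p(2))
qed

end
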